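(* Let $P=\frac1{2^3}\delta_1+\frac1{2^2}\delta_2+\frac12\delta_3+\sum_{j=4}^\infty\frac1{2^j}\delta_j$. The optimal set of two-means for $P$ is given by $\{Av[1,3],Av[4,\infty)\}$ with quantization error $V_2(P)=\frac57$.
   Context: $\delta_x$ denotes the Dirac measure at $x\in\mathbb R$. For a Borel probability measure $P$ on $\mathbb R$ and a nonempty finite set $\alpha\subset\mathbb R$, the distortion error is $V(P;\alpha)=\int\min_{a\in\alpha}|x-a|^2\,dP(x)$. The $n$th quantization error is $V_n(P)=\inf\{V(P;\alpha):\alpha\subset\mathbb R,\ 1\le\mathrm{card}(\alpha)\le n\}$. An optimal set of $n$-means for $P$ is a set $\alpha$ with at most $n$ points for which this infimum is attained. With $p_m=P(\{m\})$ and $i\le\ell$ positive integers, $Av[i,\ell]=\frac{\sum_{m=i}^{\ell}p_m m}{\sum_{m=i}^{\ell}p_m}$ and $Av[i,\infty)=\frac{\sum_{m=i}^{\infty}p_m m}{\sum_{m=i}^{\infty}p_m}$. *)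

theory Defs
  imports "HOL-Probability.Probability"
begin

(* The integral is taken in the extended nonnegative reals, so that a distortion error which
   is infinite is not confused with 0, as it would be with the Bochner integral. *)
definition distortion :: "real measure \<Rightarrow> real set \<Rightarrow> ennreal" where
  "distortion P \<alpha> = (\<integral>\<^sup>+x. ennreal (Min ((\<lambda>a. \<bar>x - a\<bar>\<^sup>2) ` \<alpha>)) \<partial>P)"

definition quantizers :: "nat \<Rightarrow> real set set" where
  "quantizers n = {\<alpha>. finite \<alpha> \<and> 1 \<le> card \<alpha> \<and> card \<alpha> \<le> n}"

definition quant_error :: "nat \<Rightarrow> real measure \<Rightarrow> ennreal" where
  "quant_error n P = (INF \<alpha>\<in>quantizers n. distortion P \<alpha>)"

definition optimal_means :: "nat \<Rightarrow> real measure \<Rightarrow> real set \<Rightarrow> bool" where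
  "optimal_means n P \<alpha> \<longleftrightarrow> \<alpha> \<in> quantizers n \<and> distortion P \<alpha> = quant_error n P"

(* p_m is measure P {real m}. *)
definition Av :: "real measure \<Rightarrow> nat \<Rightarrow> nat \<Rightarrow> real" where
  "Av P i l = (\<Sum>m=i..l. measure P {real m} * real m) / (\<Sum>m=i..l. measure P {real m})"

definition Av_inf :: "real measure \<Rightarrow> nat \<Rightarrow> real" where
  "Av_inf P i = (\<Sum>k. measure P {real (i + k)} * real (i + k)) / (\<Sum>k. measure P {real (i + k)})"

abbreviation dirac :: "real \<Rightarrow> real measure" where
  "dirac x \<equiv> return borel x"

definition P_set_fun :: "real set \<Rightarrow> ennreal" where
  "P_set_fun A =
     ennreal (1 / 2 ^ 3) * emeasure (dirac 1) A
   + ennreal (1 / 2 ^ 2) * emeasure (dirac 2) A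
   + ennreal (1 / 2) * emeasure (dirac 3) A
   + (\<Sum>k. ennreal (1 / 2 ^ (k + 4)) * emeasure (dirac (real (k + 4))) A)"

definition P_mix :: "real measure" where
  "P_mix = measure_of UNIV (sets borel) P_set_fun"

(* measure_of yields the null measure when its argument is not countably additive; the
   following facts show that this does not happen here. *)

lemma sets_P_mix [simp]: "sets P_mix = sets borel"
  unfolding P_mix_def by (simp add: sets.sigma_sets_eq[of borel, simplified])

lemma countably_additive_P_set_fun: "countably_additive (sets borel) P_set_fun"
proof (rule countably_additiveI)
  fix A :: "nat \<Rightarrow> real set"
  assume A: "range A \<subseteq> sets borel" and d: "disjoint_family A"
  have R: "emeasure (dirac x) (\<Union>i. A i) = (\<Sum>i. emeasure (dirac x) (A i))" for x
    using A d by (subst suminf_emeasure) auto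
  have sw: "(\<Sum>k. \<Sum>i. f k i) = (\<Sum>i. \<Sum>k. f k i)" for f :: "nat \<Rightarrow> nat \<Rightarrow> ennreal"
    using nn_integral_suminf[of "\<lambda>i k. f k i" "count_space (UNIV :: nat set)"]
    by (simp add: nn_integral_count_space_nat)
  have add: "(\<Sum>i. f i + g i) = suminf f + suminf g" for f g :: "nat \<Rightarrow> ennreal"
    by (rule suminf_add[symmetric]) auto
  show "(\<Sum>i. P_set_fun (A i)) = P_set_fun (\<Union>i. A i)"
    unfolding P_set_fun_def R add ennreal_suminf_cmult[symmetric]
    by (subst sw) (rule refl)
qed

lemma emeasure_P_mix: "A \<in> sets borel \<Longrightarrow> emeasure P_mix A = P_set_fun A"
  unfolding P_mix_def
  by (rule emeasure_measure_of_sigma)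
     (use countably_additive_P_set_fun sets.sigma_algebra_axioms[of "borel :: real measure"]
      in \<open>auto simp: positive_def P_set_fun_def\<close>)

lemma space_P_mix [simp]: "space P_mix = UNIV"
  unfolding P_mix_def by simp

lemma prob_space_P_mix: "prob_space P_mix"
proof
  have "(\<lambda>k. (1 / 2 :: real) ^ k * (1 / 16)) sums (2 * (1 / 16))"
    using sums_mult2[OF geometric_sums[of "1 / 2 :: real"], of "1 / 16"] by simp
  then have "(\<lambda>k. 1 / 2 ^ (k + 4) :: real) sums (1 / 8)"
    by (simp add: power_add power_one_over field_simps)
  then have "(\<Sum>k. ennreal (1 / 2 ^ (k + 4))) = ennreal (1 / 8)"
    by (intro sums_unique[symmetric]) (simp add: sums_ennreal del: power_add)
  then have "emeasure P_mix UNIV = ennreal (1/8) + ennreal (1/4) + ennreal (1/2) + ennreal (1/8)"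
    by (simp add: emeasure_P_mix P_set_fun_def)
  also have "\<dots> = ennreal (1/8 + 1/4 + 1/2 + 1/8)"
    by (simp only: ennreal_plus zero_le_divide_1_iff zero_le_numeral add_nonneg_nonneg)
  also have "\<dots> = 1"
    by simp
  finally show "emeasure P_mix (space P_mix) = 1" by simp
qed

end

theory Submission
  imports Defs "HOL-Real_Asymp.Real_Asymp"
begin

text \<open>
  For \<open>a \<le> b\<close> the integers up to the midpoint of \<open>a\<close> and \<open>b\<close> are served by \<open>a\<close> and the others
  by \<open>b\<close>. Hence the distortion of \<open>{a, b}\<close> is the quadratic function of \<open>(a, b)\<close> belonging to
  a cut \<open>k\<close>, the largest index served by \<open>a\<close>. Completing squares, the minimum is \<open>5/7\<close> for
  \<open>k = 3\<close>, attained only at \<open>(17/7, 5)\<close>. It exceeds \<open>5/7\<close> for every other cut; if \<open>k \<ge> 5\<close>, this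
  is already so for the contribution of the points \<open>1, \<dots>, 5\<close>.
\<close>

section \<open>The measure as a series of point masses on the naturals\<close>

text \<open>Index 0 gets mass zero so that all series can run over the whole of \<open>nat\<close>;
  from index 4 on the masses are geometric.\<close>

definition weight :: "nat \<Rightarrow> real" where
  "weight j = (if j = 0 then 0 else if j = 1 then 1/8 else if j = 2 then 1/4
     else if j = 3 then 1/2 else 1 / 2 ^ j)"

lemma weight_nonneg: "0 \<le> weight j"
  by (simp add: weight_def)

lemma sum_lessThan_4: "sum f {..<4::nat} = f 0 + f 1 + f 2 + f 3"
  and sum_lessThan_5: "sum f {..<5::nat} = f 0 + f 1 + f 2 + f 3 + f 4"
  and sum_lessThan_6: "sum f {..<6::nat} = f 0 + f 1 + f 2 + f 3 + f 4 + f 5"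
  for f :: "nat \<Rightarrow> 'a::comm_monoid_add"
  by (simp_all add: numeral_eq_Suc)

lemma P_set_fun_eq_suminf:
  "P_set_fun A = (\<Sum>j. ennreal (weight j) * indicator A (real j))" if "A \<in> sets borel"
proof -
  let ?f = "\<lambda>j. ennreal (weight j) * indicator A (real j)"
  have "(\<Sum>j. ?f j) = (\<Sum>j. ?f (j + 4)) + sum ?f {..<4}"
    by (rule suminf_offset) simp
  also have "(\<Sum>j. ?f (j + 4)) =
      (\<Sum>k. ennreal (1 / 2 ^ (k + 4)) * emeasure (dirac (real (k + 4))) A)"
    using that by (simp add: weight_def)
  finally show ?thesis
    using that by (simp add: P_set_fun_def sum_lessThan_4 weight_def ac_simps)
qed

text \<open>Written as the image of a density on the naturals, the measure turns integrals into
  series.\<close>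

lemma P_mix_eq_distr:
  "P_mix = distr (density (count_space UNIV) (\<lambda>j. ennreal (weight j))) borel real"
proof (rule measure_eqI)
  fix A :: "real set"
  assume "A \<in> sets P_mix"
  then have A: "A \<in> sets borel" by simp
  have "emeasure (distr (density (count_space UNIV) (\<lambda>j. ennreal (weight j))) borel real) A
      = (\<integral>\<^sup>+j. ennreal (weight j) * indicator (real -` A) j \<partial>count_space UNIV)"
    using A by (simp add: emeasure_distr emeasure_density)
  also have "\<dots> = P_set_fun A"
    by (simp add: P_set_fun_eq_suminf[OF A] nn_integral_count_space_nat indicator_def)
  finally show "emeasure P_mix A =
      emeasure (distr (density (count_space UNIV) (\<lambda>j. ennreal (weight j))) borel real) A"
    using A by (simp add: emeasure_P_mix)
qed simp

lemma nn_integral_P_mix: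
  assumes "f \<in> borel_measurable borel"
  shows "(\<integral>\<^sup>+x. f x \<partial>P_mix) = (\<Sum>j. ennreal (weight j) * f (real j))"
  using assms
  by (simp add: P_mix_eq_distr nn_integral_distr nn_integral_density nn_integral_count_space_nat)

lemma measure_P_mix: "measure P_mix {real m} = weight m"
proof -
  have "emeasure P_mix {real m} = (\<Sum>j. ennreal (weight j) * indicator {real m} (real j))"
    by (simp add: emeasure_P_mix P_set_fun_eq_suminf)
  also have "\<dots> = (\<Sum>j\<in>{m}. ennreal (weight j) * indicator {real m} (real j))"
    by (rule suminf_finite) auto
  finally show ?thesis
    by (simp add: measure_def weight_nonneg)
qed

section \<open>Closed forms of the tail series\<close>

text \<open>The geometric law with masses \<open>1 / 2 ^ (k + 1)\<close> has mean 1 and variance 2;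
  the sum is twice its second moment about \<open>c\<close>.\<close>

lemma sums_square:
  "(\<lambda>k. (real k - c)\<^sup>2 / 2 ^ k) sums (2 * (c - 1)\<^sup>2 + 4)"
proof -
  \<comment> \<open>The telescoping sequence is the remainder of the series from index
    \<open>k\<close> on: the claimed value with \<open>c - k\<close> for \<open>c\<close>, scaled by
    \<open>1 / 2 ^ k\<close>.\<close>
  have "(\<lambda>k. (2 * (c - 1 - real k)\<^sup>2 + 4) / 2 ^ k) \<longlonglongrightarrow> 0"
    by real_asymp
  from telescope_sums'[OF this]
  have "(\<lambda>k. (2 * (c - 1 - real k)\<^sup>2 + 4) / 2 ^ k - (2 * (c - 1 - real (Suc k))\<^sup>2 + 4) / 2 ^ Suc k)
     sums (2 * (c - 1)\<^sup>2 + 4)" by simp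
  moreover have "(2 * (c - 1 - real k)\<^sup>2 + 4) / 2 ^ k - (2 * (c - 1 - real (Suc k))\<^sup>2 + 4) / 2 ^ Suc k
     = (real k - c)\<^sup>2 / 2 ^ k" for k
  proof -
    have "(2 * (c - 1 - real k)\<^sup>2 + 4) - ((c - 1 - real (Suc k))\<^sup>2 + 2) = (real k - c)\<^sup>2"
      by (simp add: power2_eq_square algebra_simps)
    then show ?thesis by (simp add: divide_simps)
  qed
  ultimately show ?thesis by simp
qed

lemma sums_square_tail:
  "(\<lambda>k. (real (k + n) - b)\<^sup>2 / 2 ^ (k + n)) sums ((2 * (b - real n - 1)\<^sup>2 + 4) / 2 ^ n)"
  using sums_divide[OF sums_square[of "b - real n"], of "2 ^ n"]
  by (simp add: power_add diff_diff_eq2)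

lemma sums_mass_tail: "(\<lambda>k. 1 / 2 ^ (k + n)) sums (2 / 2 ^ n :: real)"
  using sums_divide[OF geometric_sums[of "1 / 2 :: real"], of "2 ^ n"]
  by (simp add: power_add power_one_over)

lemma sums_moment_tail: "(\<lambda>k. real (k + n) / 2 ^ (k + n)) sums (2 * (real n + 1) / 2 ^ n)"
proof -
  \<comment> \<open>Again the remainder from index \<open>k\<close> on, here of the series of
    \<open>real (k + n) / 2 ^ k\<close>.\<close>
  have "(\<lambda>k. 2 * (real k + real n + 1) / 2 ^ k) \<longlonglongrightarrow> 0"
    by real_asymp
  from telescope_sums'[OF this]
  have "(\<lambda>k. 2 * (real k + real n + 1) / 2 ^ k - 2 * (real (Suc k) + real n + 1) / 2 ^ Suc k)
     sums (2 * (real n + 1))" by simp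
  moreover have "2 * (real k + real n + 1) / 2 ^ k - 2 * (real (Suc k) + real n + 1) / 2 ^ Suc k
     = real (k + n) / 2 ^ k" for k
    by (simp add: divide_simps)
  ultimately have "(\<lambda>k. real (k + n) / 2 ^ k) sums (2 * (real n + 1))" by simp
  from sums_divide[OF this, of "2 ^ n"] show ?thesis
    by (simp add: power_add)
qed

lemma Av_1_3: "Av P_mix 1 3 = 17 / 7"
proof -
  have "{1..3} = {1, 2, 3::nat}" by auto
  then show ?thesis
    by (simp add: Av_def measure_P_mix weight_def)
qed

lemma Av_inf_4: "Av_inf P_mix 4 = 5"
proof -
  have "weight (4 + k) = 1 / 2 ^ (k + 4)" for k
    by (simp add: weight_def add.commute)
  moreover have "(\<Sum>k. 1 / 2 ^ (k + 4)) = (1 / 8 :: real)"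
    using sums_unique[OF sums_mass_tail[of 4]] by simp
  moreover have "(\<Sum>k. 1 / 2 ^ (k + 4) * real (4 + k)) = 5 / 8"
    using sums_unique[OF sums_moment_tail[of 4]] by (simp add: add.commute)
  ultimately show ?thesis
    by (simp only: Av_inf_def measure_P_mix) simp
qed

section \<open>Minimal cost for a fixed cut\<close>

text \<open>The cut \<open>k\<close> is a free parameter, not tied to the midpoint of
  \<open>a\<close> and \<open>b\<close>; this makes the total quadratic in \<open>(a, b)\<close> for
  each fixed \<open>k\<close>.\<close>

definition cut_cost :: "nat \<Rightarrow> real \<Rightarrow> real \<Rightarrow> nat \<Rightarrow> real" where
  "cut_cost k a b j = weight j * (if j \<le> k then (real j - a)\<^sup>2 else (real j - b)\<^sup>2)"

lemma cut_cost_nonneg: "0 \<le> cut_cost k a b j"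
  by (simp add: cut_cost_def weight_nonneg)

text \<open>Beyond \<open>n\<close> every point is served by \<open>b\<close> and has geometric
  mass, so the remainder has a closed form.\<close>

lemma cut_cost_sums:
  assumes "k \<le> n" "3 \<le> n"
  shows "cut_cost k a b sums
    ((2 * (b - real n - 2)\<^sup>2 + 4) / 2 ^ Suc n + (\<Sum>j<Suc n. cut_cost k a b j))"
proof -
  have "(\<lambda>j. cut_cost k a b (j + Suc n)) = (\<lambda>j. (real (j + Suc n) - b)\<^sup>2 / 2 ^ (j + Suc n))"
    using assms by (auto simp: cut_cost_def weight_def fun_eq_iff)
  then have "(\<lambda>j. cut_cost k a b (j + Suc n)) sums ((2 * (b - real n - 2)\<^sup>2 + 4) / 2 ^ Suc n)"
    using sums_square_tail[of "Suc n" b] by (simp add: algebra_simps)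
  then show ?thesis
    by (rule iffD1[OF sums_iff_shift])
qed

lemma summable_cut_cost: "summable (cut_cost k a b)"
  using cut_cost_sums[of k "k + 3" a b] by (simp add: sums_iff)

lemma suminf_cut_cost:
  assumes "k \<le> 4"
  shows "suminf (cut_cost k a b) =
    (2 * (b - 6)\<^sup>2 + 4) / 32 + cut_cost k a b 1 + cut_cost k a b 2 + cut_cost k a b 3
      + cut_cost k a b 4"
proof -
  have "cut_cost k a b 0 = 0"
    by (simp add: cut_cost_def weight_def)
  then show ?thesis
    using sums_unique[OF cut_cost_sums[of k 4 a b]] assms
    by (simp add: sum_lessThan_5)
qed

text \<open>Decomposition into within-cell and between-centre parts: 7/8 and 1/8 are the masses of
  the two cells, 17/7 and 5 their means, and 5/7 = 13/28 + 1/4 adds up their mass-weighted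
  variances.\<close>

lemma suminf_cut_cost_3:
  "suminf (cut_cost 3 a b) = 5/7 + 7/8 * (a - 17/7)\<^sup>2 + 1/8 * (b - 5)\<^sup>2"
  by (simp add: suminf_cut_cost cut_cost_def weight_def power2_eq_square field_simps)

lemma suminf_cut_cost_gt:
  assumes "k \<noteq> 3"
  shows "5/7 < suminf (cut_cost k a b)"
proof -
  consider "k = 0" | "k = 1" | "k = 2" | "k = 4" | "5 \<le> k"
    using assms by linarith
  then show ?thesis
  proof cases
    case 1
    then have "suminf (cut_cost k a b) = 23/16 + (b - 11/4)\<^sup>2"
      by (simp add: suminf_cut_cost cut_cost_def weight_def power2_eq_square field_simps)
    then show ?thesis
      using zero_le_power2[of "b - 11/4"] by linarith
  next
    case 2
    then have "suminf (cut_cost k a b) = 1 + 1/8 * (a - 1)\<^sup>2 + 7/8 * (b - 3)\<^sup>2"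
      by (simp add: suminf_cut_cost cut_cost_def weight_def power2_eq_square field_simps)
    then show ?thesis
      using zero_le_power2[of "a - 1"] zero_le_power2[of "b - 3"] by linarith
  next
    case 3
    then have "suminf (cut_cost k a b) = 11/15 + 3/8 * (a - 5/3)\<^sup>2 + 5/8 * (b - 17/5)\<^sup>2"
      by (simp add: suminf_cut_cost cut_cost_def weight_def power2_eq_square field_simps)
    then show ?thesis
      using zero_le_power2[of "a - 5/3"] zero_le_power2[of "b - 17/5"] by linarith
  next
    case 4
    then have "suminf (cut_cost k a b) = 11/15 + 15/16 * (a - 38/15)\<^sup>2 + 1/16 * (b - 6)\<^sup>2"
      by (simp add: suminf_cut_cost cut_cost_def weight_def power2_eq_square field_simps)
    then show ?thesis
      using zero_le_power2[of "a - 38/15"] zero_le_power2[of "b - 6"] by linarith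
  next
    case 5
    \<comment> \<open>All of 1, ..., 5 are served by \<open>a\<close>; they have mass 31/32 and mean
      81/31, which gives a bound uniform in \<open>k\<close>. The points 1, ..., 4 alone would give
      only 73/120 < 5/7.\<close>
    then have "sum (cut_cost k a b) {..<6} = 393/496 + 31/32 * (a - 81/31)\<^sup>2"
      by (simp add: sum_lessThan_6 cut_cost_def weight_def power2_eq_square field_simps)
    moreover have "sum (cut_cost k a b) {..<6} \<le> suminf (cut_cost k a b)"
      by (rule sum_le_suminf) (auto simp: summable_cut_cost cut_cost_nonneg)
    ultimately show ?thesis
      using zero_le_power2[of "a - 81/31"] by linarith
  qed
qed

lemma five_sevenths_le_suminf_cut_cost: "5/7 \<le> suminf (cut_cost k a b)"
  using suminf_cut_cost_gt[of k a b] by (cases "k = 3") (auto simp: suminf_cut_cost_3)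

lemma suminf_cut_cost_eq_iff:
  "suminf (cut_cost k a b) = 5/7 \<longleftrightarrow> k = 3 \<and> a = 17/7 \<and> b = 5"
proof (cases "k = 3")
  case True
  have "7/8 * (a - 17/7)\<^sup>2 + 1/8 * (b - 5)\<^sup>2 = 0 \<longleftrightarrow> a = 17/7 \<and> b = 5"
    by (subst add_nonneg_eq_0_iff) auto
  then show ?thesis
    unfolding True suminf_cut_cost_3 by linarith
next
  case False
  then show ?thesis
    using suminf_cut_cost_gt[OF False, of a b] by simp
qed

section \<open>From two-point sets to cuts\<close>

lemma min_square_eq:
  fixes a b x :: real
  assumes "a \<le> b"
  shows "min ((x - a)\<^sup>2) ((x - b)\<^sup>2) = (if x \<le> (a + b) / 2 then (x - a)\<^sup>2 else (x - b)\<^sup>2)"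
proof -
  have eq: "(x - b)\<^sup>2 - (x - a)\<^sup>2 = 2 * (b - a) * ((a + b) / 2 - x)"
    by (simp add: power2_eq_square field_simps)
  show ?thesis
  proof (cases "x \<le> (a + b) / 2")
    case True
    then have "0 \<le> (x - b)\<^sup>2 - (x - a)\<^sup>2"
      unfolding eq using assms by (intro mult_nonneg_nonneg) auto
    then show ?thesis using True by simp
  next
    case False
    then have "(x - b)\<^sup>2 - (x - a)\<^sup>2 \<le> 0"
      unfolding eq using assms by (intro mult_nonneg_nonpos) auto
    then show ?thesis using False by simp
  qed
qed

text \<open>The condition on \<open>k\<close> leaves out \<open>j = 0\<close>, which has mass zero;
  thus \<open>k = 0\<close> is admissible even when the midpoint is negative.\<close>

lemma distortion_pair:
  assumes "a \<le> b" and cut: "\<And>j. 1 \<le> j \<Longrightarrow> j \<le> k \<longleftrightarrow> real j \<le> (a + b) / 2"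
  shows "distortion P_mix {a, b} = ennreal (suminf (cut_cost k a b))"
proof -
  have "distortion P_mix {a, b} = (\<integral>\<^sup>+x. ennreal (min (\<bar>x - a\<bar>\<^sup>2) (\<bar>x - b\<bar>\<^sup>2)) \<partial>P_mix)"
    by (cases "a = b") (simp_all add: distortion_def)
  also have "\<dots> = (\<Sum>j. ennreal (weight j) * ennreal (min (\<bar>real j - a\<bar>\<^sup>2) (\<bar>real j - b\<bar>\<^sup>2)))"
    by (rule nn_integral_P_mix) measurable
  also have "\<dots> = (\<Sum>j. ennreal (cut_cost k a b j))"
  proof (rule suminf_cong)
    fix j
    show "ennreal (weight j) * ennreal (min (\<bar>real j - a\<bar>\<^sup>2) (\<bar>real j - b\<bar>\<^sup>2))
        = ennreal (cut_cost k a b j)"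
    proof (cases "j = 0")
      case False
      then have "min ((real j - a)\<^sup>2) ((real j - b)\<^sup>2)
          = (if j \<le> k then (real j - a)\<^sup>2 else (real j - b)\<^sup>2)"
        using cut[of j] by (simp only: min_square_eq[OF assms(1)])
      then show ?thesis
        by (simp add: cut_cost_def weight_nonneg ennreal_mult)
    qed (simp add: cut_cost_def weight_def)
  qed
  also have "\<dots> = ennreal (suminf (cut_cost k a b))"
    by (rule suminf_ennreal2) (simp_all add: cut_cost_nonneg summable_cut_cost)
  finally show ?thesis .
qed

lemma distortion_optimal_pair: "distortion P_mix {17/7, 5} = ennreal (5/7)"
proof -
  have "distortion P_mix {17/7, 5} = ennreal (suminf (cut_cost 3 (17/7) 5))"
  proof (rule distortion_pair)
    fix j :: nat
    \<comment> \<open>The midpoint is 26/7, strictly between 3 and 4.\<close>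
    show "j \<le> 3 \<longleftrightarrow> real j \<le> (17/7 + 5) / 2"
      by (simp add: field_simps) linarith
  qed simp
  then show ?thesis by (simp add: suminf_cut_cost_3)
qed

text \<open>Singletons are covered by \<open>a = b\<close>.\<close>

lemma quantizers_2_eq: "quantizers 2 = {{a, b} | a b. a \<le> b}"
proof (intro equalityI subsetI)
  fix \<alpha> :: "real set"
  assume "\<alpha> \<in> quantizers 2"
  then have "card \<alpha> = 1 \<or> card \<alpha> = 2"
    by (auto simp: quantizers_def)
  then obtain a b where "\<alpha> = {a, b}"
    by (auto simp: card_1_singleton_iff card_2_iff)
  then have "\<alpha> = {min a b, max a b}" by (auto simp: min_def max_def)
  then show "\<alpha> \<in> {{a, b} | a b. a \<le> b}"
    using min.cobounded1[of a b] max.cobounded1[of a b] order_trans by blast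
qed (auto simp: quantizers_def card_insert_if)

lemma distortion_quantizer_2:
  assumes "\<alpha> \<in> quantizers 2"
  shows "ennreal (5/7) \<le> distortion P_mix \<alpha>"
    and "distortion P_mix \<alpha> = ennreal (5/7) \<Longrightarrow> \<alpha> = {17/7, 5}"
proof -
  obtain a b where \<alpha>: "\<alpha> = {a, b}" "a \<le> b"
    using assms by (auto simp: quantizers_2_eq)
  \<comment> \<open>A negative floor is truncated to 0, the cut for which \<open>b\<close> serves
    every point of positive mass.\<close>
  define k where "k = nat \<lfloor>(a + b) / 2\<rfloor>"
  have "j \<le> k \<longleftrightarrow> real j \<le> (a + b) / 2" if "1 \<le> j" for j
    using that unfolding k_def by linarith
  then have eq: "distortion P_mix \<alpha> = ennreal (suminf (cut_cost k a b))"
    unfolding \<alpha>(1) by (rule distortion_pair[OF \<alpha>(2)])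
  show "ennreal (5/7) \<le> distortion P_mix \<alpha>"
    unfolding eq by (intro ennreal_leI five_sevenths_le_suminf_cut_cost)
  assume "distortion P_mix \<alpha> = ennreal (5/7)"
  \<comment> \<open>The lower bound supplies the nonnegativity needed for injectivity of
    \<open>ennreal\<close>.\<close>
  then have "suminf (cut_cost k a b) = 5/7"
    using five_sevenths_le_suminf_cut_cost[of k a b] unfolding eq
    by (subst (asm) ennreal_inj) auto
  then show "\<alpha> = {17/7, 5}"
    unfolding suminf_cut_cost_eq_iff \<alpha>(1) by blast
qed

theorem proposition4p2p1:
  "(\<forall>\<alpha>. optimal_means 2 P_mix \<alpha> \<longleftrightarrow> \<alpha> = {Av P_mix 1 3, Av_inf P_mix 4})
   \<and> quant_error 2 P_mix = ennreal (5 / 7)"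
proof -
  have opt: "{17/7, 5} \<in> quantizers 2"
    by (simp add: quantizers_def)
  have err: "quant_error 2 P_mix = ennreal (5/7)"
    unfolding quant_error_def
  proof (rule antisym)
    show "(INF \<alpha>\<in>quantizers 2. distortion P_mix \<alpha>) \<le> ennreal (5/7)"
      using INF_lower[OF opt, of "distortion P_mix"] by (simp add: distortion_optimal_pair)
    show "ennreal (5/7) \<le> (INF \<alpha>\<in>quantizers 2. distortion P_mix \<alpha>)"
      by (rule INF_greatest) (rule distortion_quantizer_2(1))
  qed
  have "optimal_means 2 P_mix \<alpha> \<longleftrightarrow> \<alpha> = {17/7, 5}" for \<alpha>
    unfolding optimal_means_def err
    using opt distortion_optimal_pair distortion_quantizer_2(2) by metis
  with err show ?thesis
    unfolding Av_1_3 Av_inf_4 by blast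
qed

end
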